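(* Consider the General-Label-Model with label set $[N]$, and let $G$ be an $n$-cycle. Let ${\bf T}$ be a randomized $q$-query partition oracle using $r$ random bits. For any $r=O(1)$, the following holds: there is a labeling of the vertices of $G$ by distinct labels from $[N]$ such that, with probability $1$ over the random choice in ${\bf T}$, at least $0.99n$ vertices are cut.
   Context: General-Label-Model: the input graph has $n$ vertices and maximum degree at most $d$ (here $d=2$); each vertex carries a distinct label in $[N]$; $N$, $n$ and $d$ are known to the algorithm, with $n=g^{-1}(N)\ll N$ for a sufficiently slowly growing function $g$ (so $N$ is taken sufficiently large as a function of $n$). Queries: label queries (given $i\in[n]$, return the label of the $i$-th vertex in an arbitrary fixed order) and neighbor queries (given a label and $r\le d$, return the label of the $r$-th neighbor). A $q$-query (cut-function) partition oracle is a deterministic algorithm that takes a vertex label as input and outputs a bit, where $1$ means the vertex is cut; it makes at most $q$ queries to the graph, and it guarantees that, after removing all edges of the cycle incident... more precisely, the connected components obtained from $G$ by declaring the cut vertices as separating the cycle (a cut edge yields two cut vertices at its ends) all have size at most $q$. A vertex is "cut" if the oracle outputs $1$ on it. A randomized partition oracle using $r$ random bits is a collection of $2^r$ such deterministic oracles, one of which is chosen uniformly at random before the algorithm starts.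
   Formalization: The two neighbors of each vertex of the n-cycle are numbered consistently (successor first, predecessor second); for arbitrary neighbor numberings the claim fails, since the numbering can mark edges for the oracle. The query bound q is a constant and n is large in terms of q and r. *)

theory Defs
  imports "HOL-Probability.Probability"
begin

text \<open>
  All index ranges are 0-based: \<open>[n]\<close> is \<open>{..<n}\<close>, \<open>[N]\<close> is \<open>{..<N}\<close>, and the neighbours of
  a vertex are numbered \<open>0, \<dots>, d - 1\<close>.

  The vertices are identified with their position in the fixed order that label queries refer to:
  vertex \<open>i\<close> is the \<open>i\<close>-th vertex.  Since \<open>adj\<close> is arbitrary, this order is unrelated to the
  graph structure.  The list \<open>adj v\<close> is the ordered list of neighbours of \<open>v\<close>.
\<close>

definition model_graph :: "nat \<Rightarrow> nat \<Rightarrow> (nat \<Rightarrow> nat list) \<Rightarrow> bool" where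
  "model_graph n d adj \<longleftrightarrow>
     (\<forall>v<n. distinct (adj v) \<and> length (adj v) \<le> d \<and> set (adj v) \<subseteq> {..<n} - {v} \<and>
            (\<forall>w \<in> set (adj v). v \<in> set (adj w)))"

definition labeling :: "nat \<Rightarrow> nat \<Rightarrow> (nat \<Rightarrow> nat) \<Rightarrow> bool" where
  "labeling n N lab \<longleftrightarrow> inj_on lab {..<n} \<and> lab ` {..<n} \<subseteq> {..<N}"

text \<open>The enumeration \<open>c\<close> lists the vertices in the order in which the cycle visits them.\<close>

definition n_cycle :: "nat \<Rightarrow> (nat \<Rightarrow> nat list) \<Rightarrow> bool" where
  "n_cycle n adj \<longleftrightarrow> 3 \<le> n \<and> model_graph n 2 adj \<and>
     (\<exists>c. bij_betw c {..<n} {..<n} \<and>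
          (\<forall>i<n. set (adj (c i)) = {c ((i + 1) mod n), c ((i + n - 1) mod n)}))"

text \<open>
  The numbering of the two neighbours of each vertex carries information: an arbitrary numbering
  could mark every tenth edge of the cycle.  In an oriented cycle it does not, as the first
  neighbour is the successor and the second the predecessor in one direction of travel.
\<close>

definition oriented_n_cycle :: "nat \<Rightarrow> (nat \<Rightarrow> nat list) \<Rightarrow> bool" where
  "oriented_n_cycle n adj \<longleftrightarrow> n_cycle n adj \<and>
     (\<exists>c. bij_betw c {..<n} {..<n} \<and>
          (\<forall>i<n. adj (c i) = [c ((i + 1) mod n), c ((i + n - 1) mod n)]))"

text \<open>
  The query \<open>Neighbor_Query x k\<close> asks for the label of the \<open>k\<close>-th neighbour of the vertex
  labelled \<open>x\<close>; it may use any label, whether or not it has been seen before.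
  The answer \<open>None\<close> says that the requested object does not exist.
\<close>

datatype query =
    Label_Query nat
  | Neighbor_Query nat nat

fun answer :: "nat \<Rightarrow> (nat \<Rightarrow> nat list) \<Rightarrow> (nat \<Rightarrow> nat) \<Rightarrow> query \<Rightarrow> nat option" where
  "answer n adj lab (Label_Query i) = (if i < n then Some (lab i) else None)"
| "answer n adj lab (Neighbor_Query x k) =
     (if x \<in> lab ` {..<n} \<and> k < length (adj (the_inv_into {..<n} lab x))
      then Some (lab (adj (the_inv_into {..<n} lab x) ! k)) else None)"

text \<open>A deterministic algorithm with adaptive queries and Boolean output, as a decision tree.\<close>

datatype algorithm =
    Output bool
  | Ask query "nat option \<Rightarrow> algorithm"

primrec result :: "(query \<Rightarrow> nat option) \<Rightarrow> algorithm \<Rightarrow> bool" where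
  "result a (Output b) = b"
| "result a (Ask x k) = result a (k (a x))"

primrec num_queries :: "(query \<Rightarrow> nat option) \<Rightarrow> algorithm \<Rightarrow> nat" where
  "num_queries a (Output b) = 0"
| "num_queries a (Ask x k) = Suc (num_queries a (k (a x)))"

text \<open>A deterministic cut function maps the label of a vertex to the algorithm run on that vertex.\<close>

type_synonym cut_oracle = "nat \<Rightarrow> algorithm"

definition cut_vertices :: "nat \<Rightarrow> (nat \<Rightarrow> nat list) \<Rightarrow> (nat \<Rightarrow> nat) \<Rightarrow> cut_oracle \<Rightarrow> nat set" where
  "cut_vertices n adj lab A = {v. v < n \<and> result (answer n adj lab) (A (lab v))}"

text \<open>
  The connected component of \<open>v\<close> after removing all edges incident to a vertex of \<open>C\<close>; a vertex
  of \<open>C\<close> is a component of its own.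
\<close>

definition component :: "nat \<Rightarrow> (nat \<Rightarrow> nat list) \<Rightarrow> nat set \<Rightarrow> nat \<Rightarrow> nat set" where
  "component n adj C v =
     {w. (v, w) \<in> {(x, y). x < n \<and> y \<in> set (adj x) \<and> x \<notin> C \<and> y \<notin> C}\<^sup>*}"

definition partition_oracle :: "nat \<Rightarrow> nat \<Rightarrow> nat \<Rightarrow> cut_oracle \<Rightarrow> bool" where
  "partition_oracle q n N A \<longleftrightarrow>
     (\<forall>adj lab. n_cycle n adj \<longrightarrow> labeling n N lab \<longrightarrow>
        (\<forall>v<n. num_queries (answer n adj lab) (A (lab v)) \<le> q \<and>
               card (component n adj (cut_vertices n adj lab A) v) \<le> q))"

definition seeds :: "nat \<Rightarrow> bool list set" where
  "seeds r = {s. length s = r}"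

definition randomized_partition_oracle ::
    "nat \<Rightarrow> nat \<Rightarrow> nat \<Rightarrow> nat \<Rightarrow> (bool list \<Rightarrow> cut_oracle) \<Rightarrow> bool" where
  "randomized_partition_oracle q r n N T \<longleftrightarrow> (\<forall>s \<in> seeds r. partition_oracle q n N (T s))"

end

theory Submission
  imports Defs "HOL-Library.Ramsey"
begin

text \<open>
  Let the labels increase along the cycle.  By Ramsey's theorem for \<open>n\<close>-subsets of the label set
  there are \<open>2 n\<close> labels such that, whichever \<open>n\<close> of them are used, the run started at a given
  position of the cycle makes the same queries (described by positions) and has the same output, for
  every seed.  The spare labels allow local relabelling, which shows that a run never guesses the label
  of a vertex that it has not explored, and that the runs at consecutive positions \<open>t\<close> and \<open>t + 1\<close>
  agree unless \<open>t\<close> is close to a vertex reached by a label query or to the place where the increasing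
  order wraps around.  It follows by induction on the number of queries that all runs together make
  label queries to boundedly many vertices.  Hence the output is constant along the
  cycle except at boundedly many positions, and as uncut stretches have length at most \<open>q\<close>, only
  boundedly many vertices are uncut.
\<close>

section \<open>Execution of a decision tree step by step\<close>

definition step :: "(query \<Rightarrow> nat option) \<Rightarrow> algorithm \<Rightarrow> algorithm" where
  "step a alg = (case alg of Output b \<Rightarrow> Output b | Ask x k \<Rightarrow> k (a x))"

lemma step_simps [simp]:
  "step a (Output b) = Output b"
  "step a (Ask x k) = k (a x)"
  by (simp_all add: step_def)

text \<open>Outputs are fixed points of \<open>step\<close>, so runs of different lengths can be
  compared at any common time \<open>p\<close>; at time \<open>q\<close> all runs within the query
  budget show their answer.\<close>

definition state :: "(query \<Rightarrow> nat option) \<Rightarrow> algorithm \<Rightarrow> nat \<Rightarrow> algorithm" where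
  "state a alg p = (step a ^^ p) alg"

lemma state_0 [simp]: "state a alg 0 = alg"
  by (simp add: state_def)

lemma state_Suc: "state a alg (Suc p) = step a (state a alg p)"
  by (simp add: state_def)

lemma state_Suc': "state a alg (Suc p) = state a (step a alg) p"
  by (simp add: state_def funpow_swap1)

lemma state_Output: "state a (Output b) p = Output b"
  by (induction p) (simp_all add: state_Suc)

lemma state_eq_Output:
  "num_queries a alg \<le> p \<Longrightarrow> state a alg p = Output (result a alg)"
proof (induction p arbitrary: alg)
  case 0
  then show ?case by (cases alg) simp_all
next
  case (Suc p)
  show ?case
  proof (cases alg)
    case (Output b)
    then show ?thesis by (simp add: state_Output)
  next
    case (Ask x k)
    with Suc show ?thesis by (simp add: state_Suc')
  qed
qed

section \<open>Runs described by positions on the cycle\<close>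

datatype action = Returns bool | Label_At nat | Neighbor_At nat | Void

text \<open>Positions along the cycle, not vertices, index everything below: the argument compares
  the runs of the oracle at consecutive positions.\<close>

locale directed_cycle =
  fixes n :: nat and adj :: "nat \<Rightarrow> nat list" and c :: "nat \<Rightarrow> nat"
  assumes n_ge_3: "3 \<le> n"
    and bij_c: "bij_betw c {..<n} {..<n}"
    and adj_c: "\<And>i. i < n \<Longrightarrow> adj (c i) = [c ((i + 1) mod n), c ((i + n - 1) mod n)]"
begin

definition pos :: "nat \<Rightarrow> nat" where
  "pos = the_inv_into {..<n} c"

lemma c_less: "i < n \<Longrightarrow> c i < n"
  using bij_betwE[OF bij_c] by simp

lemma pos_c [simp]: "i < n \<Longrightarrow> pos (c i) = i"
  using bij_c by (simp add: pos_def bij_betw_def the_inv_into_f_f)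

lemma c_pos [simp]: "v < n \<Longrightarrow> c (pos v) = v"
  using f_the_inv_into_f_bij_betw[OF bij_c] by (simp add: pos_def)

lemma pos_less: "v < n \<Longrightarrow> pos v < n"
  using bij_betwE[OF bij_betw_the_inv_into[OF bij_c]] by (simp add: pos_def)

lemma bij_pos: "bij_betw pos {..<n} {..<n}"
  unfolding pos_def by (rule bij_betw_the_inv_into[OF bij_c])

lemma pos_image: "pos ` {..<n} = {..<n}"
  using bij_pos by (simp add: bij_betw_def)

lemma inj_on_label_pos:
  assumes "inj_on \<rho> {..<n}"
  shows "inj_on (\<lambda>v. \<rho> (pos v)) {..<n}"
  using comp_inj_on[of pos "{..<n}" \<rho>] bij_pos assms
  by (simp add: bij_betw_def comp_def)

text \<open>Here \<open>\<rho>\<close> labels positions; composing with \<open>pos\<close> turns it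
  into a labelling of vertices.\<close>

definition ans :: "(nat \<Rightarrow> nat) \<Rightarrow> query \<Rightarrow> nat option" where
  "ans \<rho> = answer n adj (\<lambda>v. \<rho> (pos v))"

lemma label_pos_image: "(\<lambda>v. \<rho> (pos v)) ` {..<n} = \<rho> ` {..<n}"
  using pos_image by (metis image_image)

lemma ans_Label_Query [simp]:
  "ans \<rho> (Label_Query i) = (if i < n then Some (\<rho> (pos i)) else None)"
  by (simp add: ans_def)

lemma ans_Neighbor_Query:
  assumes "inj_on \<rho> {..<n}" "u < n"
  shows "ans \<rho> (Neighbor_Query (\<rho> u) k) =
    (if k = 0 then Some (\<rho> ((u + 1) mod n)) else if k = 1 then Some (\<rho> ((u + n - 1) mod n)) else None)"
proof -
  have "the_inv_into {..<n} (\<lambda>v. \<rho> (pos v)) (\<rho> u) = c u"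
    using inj_on_label_pos[OF assms(1)] assms(2)
    by (intro the_inv_into_f_eq) (auto simp: c_less)
  moreover have "\<rho> u \<in> (\<lambda>v. \<rho> (pos v)) ` {..<n}"
    using assms(2) by (subst label_pos_image) simp
  moreover have "(u + 1) mod n < n" "(u + n - 1) mod n < n"
    using n_ge_3 by simp_all
  moreover have "k < 2 \<longleftrightarrow> k = 0 \<or> k = 1"
    by auto
  ultimately show ?thesis
    using assms(2) unfolding ans_def by (auto simp: adj_c)
qed

lemma ans_Neighbor_Query_None:
  "y \<notin> \<rho> ` {..<n} \<Longrightarrow> ans \<rho> (Neighbor_Query y k) = None"
  unfolding ans_def by (simp add: label_pos_image)

text \<open>Label values are replaced by positions so that runs under different labellings become
  comparable. The neighbour number is forgotten because it is unbounded: only finitely many actions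
  may remain, as they serve as colours for Ramsey's theorem.\<close>

fun query_action :: "(nat \<Rightarrow> nat) \<Rightarrow> query \<Rightarrow> action" where
  "query_action \<rho> (Label_Query i) = (if i < n then Label_At (pos i) else Void)"
| "query_action \<rho> (Neighbor_Query y k) =
    (if y \<in> \<rho> ` {..<n} then Neighbor_At (the_inv_into {..<n} \<rho> y) else Void)"

fun action :: "(nat \<Rightarrow> nat) \<Rightarrow> algorithm \<Rightarrow> action" where
  "action \<rho> (Output b) = Returns b"
| "action \<rho> (Ask x k) = query_action \<rho> x"

lemma action_in:
  assumes "inj_on \<rho> {..<n}"
  shows "action \<rho> alg \<in> range Returns \<union> Label_At ` {..<n} \<union> Neighbor_At ` {..<n} \<union> {Void}"
proof (cases alg)
  case (Ask x k)
  then show ?thesis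
    using the_inv_into_into[OF assms _ order.refl] by (cases x) (auto simp: pos_less)
qed simp

lemma action_Label_At:
  "action \<rho> alg = Label_At u \<longleftrightarrow> (\<exists>i k. alg = Ask (Label_Query i) k \<and> i < n \<and> pos i = u)"
proof (cases alg)
  case (Ask x k)
  then show ?thesis by (cases x) auto
qed simp

lemma action_Returns: "action \<rho> alg = Returns b \<longleftrightarrow> alg = Output b"
proof (cases alg)
  case (Ask x k)
  then show ?thesis by (cases x) auto
qed simp

lemma query_action_Neighbor_At:
  assumes "inj_on \<rho> {..<n}"
  shows "query_action \<rho> (Neighbor_Query y k) = Neighbor_At u \<longleftrightarrow> u < n \<and> y = \<rho> u"
  using the_inv_into_f_f[OF assms] by auto

lemma action_Neighbor_At:
  assumes "inj_on \<rho> {..<n}"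
  shows "action \<rho> alg = Neighbor_At u \<longleftrightarrow> (\<exists>j k. alg = Ask (Neighbor_Query (\<rho> u) j) k \<and> u < n)"
proof (cases alg)
  case (Ask x k)
  then show ?thesis
    using query_action_Neighbor_At[OF assms] by (cases x) (auto simp del: query_action.simps(2))
qed simp

text \<open>Needed because the enumeration of an \<open>n\<close>-set and a selection from the
  homogeneous labels are only known to agree below \<open>n\<close>.\<close>

lemma ans_cong:
  assumes "inj_on \<rho> {..<n}" "\<And>i. i < n \<Longrightarrow> \<rho> i = \<rho>' i"
  shows "ans \<rho> = ans \<rho>'"
proof
  fix x
  have img: "\<rho> ` {..<n} = \<rho>' ` {..<n}" and inj: "inj_on \<rho>' {..<n}"
    using assms by (auto simp: inj_on_def)
  show "ans \<rho> x = ans \<rho>' x"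
  proof (cases x)
    case (Label_Query i)
    then show ?thesis using assms(2) by (simp add: pos_less)
  next
    case (Neighbor_Query y k)
    show ?thesis
    proof (cases "y \<in> \<rho> ` {..<n}")
      case True
      then obtain u where u: "u < n" "y = \<rho> u" by blast
      then show ?thesis
        using ans_Neighbor_Query[OF assms(1), of u k] ans_Neighbor_Query[OF inj, of u k]
          assms(2)[of u] assms(2)[of "(u + 1) mod n"] assms(2)[of "(u + n - 1) mod n"]
        by (simp add: Neighbor_Query)
    next
      case False
      then show ?thesis using img by (simp add: Neighbor_Query ans_Neighbor_Query_None)
    qed
  qed
qed

lemma action_cong:
  assumes "\<And>i. i < n \<Longrightarrow> \<rho> i = \<rho>' i"
  shows "action \<rho> alg = action \<rho>' alg"
proof (cases alg)
  case (Ask x k)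
  have "\<rho> ` {..<n} = \<rho>' ` {..<n}" "the_inv_into {..<n} \<rho> = the_inv_into {..<n} \<rho>'"
    using assms by (auto simp: the_inv_into_def fun_eq_iff cong: conj_cong)
  then show ?thesis using Ask by (cases x) simp_all
qed simp

section \<open>Balls on the cycle\<close>

definition nbh :: "nat set \<Rightarrow> nat set" where
  "nbh D = D \<union> (\<lambda>u. (u + 1) mod n) ` D \<union> (\<lambda>u. (u + n - 1) mod n) ` D"

definition cyc_ball :: "nat \<Rightarrow> nat set \<Rightarrow> nat set" where
  "cyc_ball p D = (nbh ^^ p) D"

lemma cyc_ball_0 [simp]: "cyc_ball 0 D = D"
  by (simp add: cyc_ball_def)

lemma cyc_ball_Suc: "cyc_ball (Suc p) D = nbh (cyc_ball p D)"
  by (simp add: cyc_ball_def)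

lemma nbh_mono: "D \<subseteq> E \<Longrightarrow> nbh D \<subseteq> nbh E"
  by (auto simp: nbh_def)

lemma subset_nbh: "D \<subseteq> nbh D"
  by (auto simp: nbh_def)

lemma nbh_Un: "nbh (D \<union> E) = nbh D \<union> nbh E"
  by (auto simp: nbh_def)

text \<open>Splits the explored region into the part around the start, which moves with it, and the
  part around label queries, which stays in place.\<close>

lemma cyc_ball_Un: "cyc_ball p (D \<union> E) = cyc_ball p D \<union> cyc_ball p E"
  by (induction p) (simp_all add: cyc_ball_Suc nbh_Un)

lemma cyc_ball_mono: "p \<le> p' \<Longrightarrow> D \<subseteq> E \<Longrightarrow> cyc_ball p D \<subseteq> cyc_ball p' E"
proof (induction p' rule: dec_induct)
  case base
  then show ?case by (metis cyc_ball_Un Un_upper1 Un_absorb1)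
next
  case (step m)
  then show ?case using subset_nbh[of "cyc_ball m E"] by (auto simp: cyc_ball_Suc)
qed

text \<open>The answer to a neighbour query asked at time \<open>j\<close> inside the ball of radius
  \<open>j\<close> still lies in the ball belonging to any later time.\<close>

lemma nbh_cyc_ball_subset: "j < p \<Longrightarrow> D \<subseteq> E \<Longrightarrow> nbh (cyc_ball j D) \<subseteq> cyc_ball p E"
  using cyc_ball_mono[of "Suc j" p D E] by (simp add: cyc_ball_Suc)

lemma finite_cyc_ball: "finite D \<Longrightarrow> finite (cyc_ball p D)"
  by (induction p) (simp_all add: cyc_ball_Suc nbh_def)

lemma card_nbh_le: "finite D \<Longrightarrow> card (nbh D) \<le> 3 * card D"
  unfolding nbh_def
  using card_Un_le[of "D \<union> (\<lambda>u. (u + 1) mod n) ` D" "(\<lambda>u. (u + n - 1) mod n) ` D"]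
    card_Un_le[of D "(\<lambda>u. (u + 1) mod n) ` D"]
    card_image_le[of D "\<lambda>u. (u + 1) mod n"] card_image_le[of D "\<lambda>u. (u + n - 1) mod n"]
  by linarith

text \<open>A crude bound suffices, since all that matters is independence of
  \<open>n\<close>.\<close>

lemma card_cyc_ball_le: "finite D \<Longrightarrow> card (cyc_ball p D) \<le> 3 ^ p * card D"
proof (induction p)
  case (Suc p)
  then show ?case
    using card_nbh_le[OF finite_cyc_ball[OF Suc.prems, of p]] by (simp add: cyc_ball_Suc)
qed simp

lemma cyc_ball_singleton:
  assumes "p \<le> t" "t + p < n"
  shows "cyc_ball p {t} \<subseteq> {t - p..t + p}"
  using assms
proof (induction p)
  case (Suc p)
  have "nbh {t - p..t + p} \<subseteq> {t - Suc p..t + Suc p}"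
  proof
    fix x assume "x \<in> nbh {t - p..t + p}"
    then obtain u where u: "u \<in> {t - p..t + p}"
      and x: "x = u \<or> x = (u + 1) mod n \<or> x = (u + n - 1) mod n"
      unfolding nbh_def by blast
    have "u + n - 1 = (u - 1) + n" "u - 1 < n" using u Suc.prems by auto
    then have "(u + n - 1) mod n = u - 1" by (simp only: mod_add_self2 mod_less)
    moreover have "(u + 1) mod n = u + 1" using u Suc.prems by simp
    ultimately show "x \<in> {t - Suc p..t + Suc p}" using u x by auto
  qed
  with Suc show ?case using nbh_mono[of "cyc_ball p {t}" "{t - p..t + p}"] by (auto simp: cyc_ball_Suc)
qed simp

end

section \<open>Homogeneous labels and comparison of consecutive positions\<close>

text \<open>Order-preserving choices of \<open>n\<close> out of \<open>2 * n\<close> labels: each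
  one lays an \<open>n\<close>-subset of the homogeneous set increasingly along the cycle.\<close>

definition admissible :: "nat \<Rightarrow> (nat \<Rightarrow> nat) \<Rightarrow> bool" where
  "admissible n \<psi> \<longleftrightarrow> strict_mono_on {..<n} \<psi> \<and> \<psi> ` {..<n} \<subseteq> {..<2 * n}"

locale homogeneous_labels = directed_cycle +
  fixes q :: nat and A :: cut_oracle and e :: "nat \<Rightarrow> nat"
  assumes inj_e: "inj_on e {..<2 * n}"
    and homogeneous: "\<And>\<psi> \<psi>' t p. \<lbrakk>admissible n \<psi>; admissible n \<psi>'; t < n; p \<le> q\<rbrakk> \<Longrightarrow>
      action (e \<circ> \<psi>) (state (ans (e \<circ> \<psi>)) (A (e (\<psi> t))) p) =
      action (e \<circ> \<psi>') (state (ans (e \<circ> \<psi>')) (A (e (\<psi>' t))) p)"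
begin

definition st :: "(nat \<Rightarrow> nat) \<Rightarrow> nat \<Rightarrow> nat \<Rightarrow> algorithm" where
  "st \<psi> t p = state (ans (e \<circ> \<psi>)) (A (e (\<psi> t))) p"

definition act :: "(nat \<Rightarrow> nat) \<Rightarrow> nat \<Rightarrow> nat \<Rightarrow> action" where
  "act \<psi> t p = action (e \<circ> \<psi>) (st \<psi> t p)"

text \<open>The reference choice; it leaves a free odd label after each used one, which gives room
  for relabelling.\<close>

definition even_pos :: "nat \<Rightarrow> nat" where
  "even_pos i = 2 * i"

definition queried :: "nat \<Rightarrow> nat \<Rightarrow> nat set" where
  "queried p t = {u. \<exists>j<p. act even_pos t j = Label_At u}"

lemma st_0: "st \<psi> t 0 = A (e (\<psi> t))"
  by (simp add: st_def)

lemma st_Suc: "st \<psi> t (Suc p) = step (ans (e \<circ> \<psi>)) (st \<psi> t p)"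
  by (simp add: st_def state_Suc)

lemma admissible_even_pos: "admissible n even_pos"
  by (auto simp: admissible_def even_pos_def strict_mono_on_def)

lemma act_even_pos: "admissible n \<psi> \<Longrightarrow> t < n \<Longrightarrow> p \<le> q \<Longrightarrow> act \<psi> t p = act even_pos t p"
  unfolding act_def st_def by (rule homogeneous[OF _ admissible_even_pos])

lemma admissible_less: "admissible n \<psi> \<Longrightarrow> i < n \<Longrightarrow> \<psi> i < 2 * n"
  by (auto simp: admissible_def)

lemma inj_on_e_comp: "admissible n \<psi> \<Longrightarrow> inj_on (e \<circ> \<psi>) {..<n}"
  unfolding admissible_def
  by (metis comp_inj_on inj_e inj_on_subset strict_mono_on_imp_inj_on)

lemma e_eq_iff: "i < 2 * n \<Longrightarrow> j < 2 * n \<Longrightarrow> e i = e j \<longleftrightarrow> i = j"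
  using inj_on_eq_iff[OF inj_e] by simp

lemma queried_mono: "p \<le> p' \<Longrightarrow> queried p t \<subseteq> queried p' t"
  by (auto simp: queried_def intro: less_le_trans)

text \<open>The oracle cannot guess a label: moving every label outside the ball to its unused odd
  neighbour would not change the run before the guess, and would turn the guess into a miss.\<close>

lemma act_Neighbor_At_explored:
  assumes "t < n" "p \<le> q" "act even_pos t p = Neighbor_At u"
  shows "u \<in> cyc_ball p (insert t (queried p t))"
  using assms(2,3)
proof (induction p arbitrary: u rule: less_induct)
  case (less p)
  define D where "D = cyc_ball p (insert t (queried p t))"
  define \<psi> where "\<psi> i = (if i \<in> D then 2 * i else 2 * i + 1)" for i
  have adm: "admissible n \<psi>"
    by (auto simp: admissible_def \<psi>_def strict_mono_on_def)
  note adm0 = admissible_even_pos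
  have "insert t (queried p t) \<subseteq> D"
    using cyc_ball_mono[of 0 p "insert t (queried p t)" "insert t (queried p t)"]
    unfolding D_def by simp
  then have t_D: "t \<in> D" and queried_D: "queried p t \<subseteq> D"
    by auto
  have same: "\<psi> i = even_pos i" if "i \<in> D" for i
    using that by (simp add: \<psi>_def even_pos_def)
  have "st \<psi> t j = st even_pos t j" if "j \<le> p" for j
    using that
  proof (induction j)
    case 0
    then show ?case using same[OF t_D] by (simp add: st_0)
  next
    case (Suc j)
    then have IH: "st \<psi> t j = st even_pos t j" and j: "j < p" by simp_all
    show ?case
    proof (cases "st even_pos t j")
      case (Output b)
      then show ?thesis using IH by (simp add: st_Suc)
    next
      case (Ask x k)
      \<comment> \<open>Both runs ask the same \<open>x\<close>, so homogeneity makes it a hit at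
        the same position under both labellings or a miss under both.\<close>
      have hom: "query_action (e \<circ> \<psi>) x = query_action (e \<circ> even_pos) x"
        using act_even_pos[OF adm assms(1), of j] IH Ask j less.prems by (simp add: act_def)
      have "ans (e \<circ> \<psi>) x = ans (e \<circ> even_pos) x"
      proof (cases x)
        case (Label_Query i)
        show ?thesis
        proof (cases "i < n")
          case True
          then have "act even_pos t j = Label_At (pos i)"
            using Ask Label_Query by (simp add: act_def)
          then have "pos i \<in> D" using j queried_D by (auto simp: queried_def)
          then show ?thesis using Label_Query same by simp
        qed (simp add: Label_Query)
      next
        case (Neighbor_Query y l)
        show ?thesis
        proof (cases "y \<in> (e \<circ> even_pos) ` {..<n}")
          case True
          then obtain u' where u': "u' < n" "y = (e \<circ> even_pos) u'" by blast
          then have "act even_pos t j = Neighbor_At u'"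
            unfolding act_def action_Neighbor_At[OF inj_on_e_comp[OF adm0]]
            using Ask Neighbor_Query by auto
          \<comment> \<open>By the strong induction the earlier query was itself no guess, so its
            position and both neighbours lie in \<open>D\<close>, where the labels agree.\<close>
          then have "u' \<in> cyc_ball j (insert t (queried j t))"
            using less.IH[OF j] j less.prems by simp
          moreover have "nbh (cyc_ball j (insert t (queried j t))) \<subseteq> D"
            unfolding D_def using j queried_mono[of j p t] by (intro nbh_cyc_ball_subset) auto
          ultimately have "u' \<in> D" "(u' + 1) mod n \<in> D" "(u' + n - 1) mod n \<in> D"
            by (auto simp: nbh_def)
          moreover from this(1) have "y = (e \<circ> \<psi>) u'" using u' same by simp
          ultimately show ?thesis
            using ans_Neighbor_Query[OF inj_on_e_comp[OF adm], of u' l]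
              ans_Neighbor_Query[OF inj_on_e_comp[OF adm0], of u' l] u' same
            by (simp add: Neighbor_Query)
        next
          case False
          then have "y \<notin> (e \<circ> \<psi>) ` {..<n}"
            using hom Neighbor_Query by (auto split: if_splits)
          with False show ?thesis
            by (simp add: Neighbor_Query ans_Neighbor_Query_None del: comp_apply)
        qed
      qed
      then show ?thesis using IH Ask by (simp add: st_Suc)
    qed
  qed
  then have st_eq: "st \<psi> t p = st even_pos t p" by simp
  obtain l k where ask: "st even_pos t p = Ask (Neighbor_Query ((e \<circ> even_pos) u) l) k" and u: "u < n"
    using less.prems(2) unfolding act_def action_Neighbor_At[OF inj_on_e_comp[OF adm0]] by auto
  have "act \<psi> t p = Neighbor_At u"
    using act_even_pos[OF adm assms(1) less.prems(1)] less.prems(2) by simp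
  then have "e (even_pos u) = e (\<psi> u)"
    unfolding act_def action_Neighbor_At[OF inj_on_e_comp[OF adm]] st_eq ask by auto
  then have "even_pos u = \<psi> u"
    using e_eq_iff admissible_less[OF adm u] admissible_less[OF adm0 u] by blast
  then show ?case
    by (auto simp: \<psi>_def even_pos_def D_def split: if_splits)
qed

text \<open>Relabelling by \<open>\<psi>\<close> makes the surroundings of position \<open>t\<close> look exactly like those of
  \<open>t + 1\<close> while keeping the labels that the run can reach through label queries; all other
  labels become odd, so that no query to them can succeed under both labellings.\<close>

lemma st_shift:
  assumes t: "q \<le> t" "t + q + 1 < n" and p: "p \<le> q"
    and far: "cyc_ball q (queried p t) \<inter> {t - q..t + q + 1} = {}"
  obtains \<psi> where "admissible n \<psi>" "st \<psi> t p = st even_pos (t + 1) p"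
proof -
  define K where "K = cyc_ball q (queried p t)"
  define W where "W = {t - q..t + q}"
  define \<psi> where "\<psi> i = (if i \<in> W then 2 * i + 2 else if i \<in> K then 2 * i else 2 * i + 1)" for i
  have KW: "i \<notin> K" if "i \<in> W \<or> i = t + q + 1" for i
    using far that by (auto simp: K_def W_def)
  have adm: "admissible n \<psi>"
    unfolding admissible_def
  proof
    show "strict_mono_on {..<n} \<psi>"
    proof (rule strict_mono_onI)
      fix i j :: nat assume "i < j"
      show "\<psi> i < \<psi> j"
      proof (cases "i \<in> W \<and> j \<notin> W \<and> j \<in> K")
        case True
        \<comment> \<open>The last position of \<open>W\<close> takes the even label of
          \<open>t + q + 1\<close>, so that position must not keep it; this is why the window in
          \<open>far\<close> extends one step further to the right.\<close>
        then have "j \<noteq> t + q + 1" using KW[of j] by blast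
        with True have "i + 1 < j" using \<open>i < j\<close> by (auto simp: W_def)
        then show ?thesis by (simp add: \<psi>_def)
      next
        case False
        then show ?thesis using \<open>i < j\<close> by (auto simp: \<psi>_def)
      qed
    qed
    show "\<psi> ` {..<n} \<subseteq> {..<2 * n}"
      using t by (auto simp: \<psi>_def W_def)
  qed
  note adm0 = admissible_even_pos
  have tn: "t < n" and tn': "t + 1 < n" using t by simp_all
  have K: "\<psi> i = even_pos i" if "i \<in> K" for i
    using that KW by (auto simp: \<psi>_def even_pos_def)
  have W: "\<psi> i = even_pos (i + 1)" if "i \<in> W" for i
    using that by (simp add: \<psi>_def even_pos_def)
  have "st \<psi> t j = st even_pos (t + 1) j" if "j \<le> p" for j
    using that
  \<comment> \<open>Strong induction, because the case of a missed query needs that all earlier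
    label queries of the run at \<open>t + 1\<close> are also made by the run at
    \<open>t\<close>.\<close>
  proof (induction j rule: less_induct)
    case (less j')
    show ?case
    proof (cases j')
      case 0
      then show ?thesis using W[of t] by (simp add: st_0 W_def)
    next
      case (Suc j)
      then have IH: "st \<psi> t j = st even_pos (t + 1) j" and j: "j < p" "j \<le> q"
        using less p by simp_all
      have hom: "act even_pos t j = act \<psi> t j"
        using act_even_pos[OF adm tn j(2)] by simp
      show ?thesis
      proof (cases "st \<psi> t j")
        case (Output b)
        then show ?thesis using IH Suc by (simp add: st_Suc)
      next
        case (Ask x k)
        have "ans (e \<circ> \<psi>) x = ans (e \<circ> even_pos) x"
        proof (cases x)
          case (Label_Query i)
          show ?thesis
          proof (cases "i < n")
            case True
            then have "act even_pos t j = Label_At (pos i)"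
              using Ask Label_Query by (simp add: hom) (simp add: act_def)
            then have "pos i \<in> queried p t" using j by (auto simp: queried_def)
            then have "pos i \<in> K" using cyc_ball_mono[of 0 q "queried p t"] by (auto simp: K_def)
            then show ?thesis using Label_Query K by simp
          qed (simp add: Label_Query)
        next
          case (Neighbor_Query y l)
          have nbh_W: "nbh (cyc_ball j {t}) \<subseteq> W"
            using cyc_ball_singleton[of "Suc j" t] j p t by (force simp: cyc_ball_Suc W_def)
          have nbh_K: "nbh (cyc_ball j (queried j t)) \<subseteq> K"
            using j p queried_mono[of j p t] unfolding K_def by (intro nbh_cyc_ball_subset) auto
          show ?thesis
          proof (cases "y \<in> (e \<circ> \<psi>) ` {..<n}")
            case True
            then obtain u where u: "u < n" "y = (e \<circ> \<psi>) u" by blast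
            then have "act even_pos t j = Neighbor_At u"
              unfolding hom unfolding act_def action_Neighbor_At[OF inj_on_e_comp[OF adm]]
              using Ask Neighbor_Query by auto
            \<comment> \<open>Near \<open>t\<close> the label of \<open>u\<close> under \<psi> is
              the reference label of \<open>u + 1\<close>, and its neighbours are shifted alike;
              near a label query the two labellings coincide.\<close>
            from act_Neighbor_At_explored[OF tn j(2) this]
            consider "u \<in> cyc_ball j {t}" | "u \<in> cyc_ball j (queried j t)"
              using cyc_ball_Un[of j "{t}" "queried j t"] by auto
            then show ?thesis
            proof cases
              case 1
              have uj: "u \<in> {t - j..t + j}"
                using 1 cyc_ball_singleton[of j t] j t by auto
              have uW: "u \<in> W" "(u + 1) mod n \<in> W" "(u + n - 1) mod n \<in> W"
                using 1 nbh_W by (auto simp: nbh_def)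
              have "0 < u" "u + 1 < n" "u + 2 < n" using uj j p t by auto
              moreover from this have "u + n - 1 = (u - 1) + n" "u - 1 < n" by auto
              then have "(u + n - 1) mod n = u - 1" by (simp only: mod_add_self2 mod_less)
              ultimately have mods: "(u + 1) mod n = u + 1" "(u + n - 1) mod n = u - 1"
                "(u + 1 + 1) mod n = u + 2" "(u + 1 + n - 1) mod n = u" "0 < u" "u + 1 < n"
                by simp_all
              have "y = (e \<circ> even_pos) (u + 1)" using u W[OF uW(1)] by simp
              then show ?thesis
                using ans_Neighbor_Query[OF inj_on_e_comp[OF adm] u(1), of l]
                  ans_Neighbor_Query[OF inj_on_e_comp[OF adm0] mods(6), of l]
                  u(2) W[OF uW(2)] W[OF uW(3)]
                unfolding Neighbor_Query mods(1-4) using mods(5) by simp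
            next
              case 2
              then have "u \<in> K" "(u + 1) mod n \<in> K" "(u + n - 1) mod n \<in> K"
                using nbh_K by (auto simp: nbh_def)
              moreover from this(1) have "y = (e \<circ> even_pos) u" using u K by simp
              ultimately show ?thesis
                using ans_Neighbor_Query[OF inj_on_e_comp[OF adm], of u l]
                  ans_Neighbor_Query[OF inj_on_e_comp[OF adm0], of u l] u K
                by (simp add: Neighbor_Query)
            qed
          next
            case False
            \<comment> \<open>A hit at \<open>u\<close> under the reference labelling would lie in
              the region explored from \<open>t + 1\<close>; there \<open>y\<close> is the
              \<psi>-label of \<open>u - 1\<close> or of \<open>u\<close>, so it would be a hit
              under \<psi> as well.\<close>
            have "y \<notin> (e \<circ> even_pos) ` {..<n}"
            proof
              assume "y \<in> (e \<circ> even_pos) ` {..<n}"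
              then obtain u where u: "u < n" "y = (e \<circ> even_pos) u" by blast
              then have "act even_pos (t + 1) j = Neighbor_At u"
                unfolding act_def action_Neighbor_At[OF inj_on_e_comp[OF adm0]]
                using Ask Neighbor_Query IH by auto
              from act_Neighbor_At_explored[OF tn' j(2) this]
              consider "u \<in> cyc_ball j {t + 1}" | "u \<in> cyc_ball j (queried j (t + 1))"
                using cyc_ball_Un[of j "{t + 1}" "queried j (t + 1)"] by auto
              then show False
              proof cases
                case 1
                then have "u \<in> {t + 1 - j..t + 1 + j}"
                  using cyc_ball_singleton[of j "t + 1"] j p t by auto
                then have "u - 1 \<in> W" "0 < u" using j p t by (auto simp: W_def)
                then have "y = (e \<circ> \<psi>) (u - 1)" using W[of "u - 1"] u by simp
                then show False using False u(1) by (auto simp del: comp_apply)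
              next
                case 2
                have "queried j (t + 1) \<subseteq> queried j t"
                proof
                  fix v assume "v \<in> queried j (t + 1)"
                  then obtain i where i: "i < j" "act even_pos (t + 1) i = Label_At v"
                    by (auto simp: queried_def)
                  have "act \<psi> t i = Label_At v"
                    using i less.IH[of i] Suc less.prems
                    by (simp add: act_def action_Label_At)
                  then show "v \<in> queried j t"
                    using i act_even_pos[OF adm tn, of i] j by (auto simp: queried_def)
                qed
                then have "u \<in> K"
                  using 2 cyc_ball_mono[of j j "queried j (t + 1)" "queried j t"] nbh_K
                    subset_nbh by blast
                then have "y = (e \<circ> \<psi>) u" using K u by simp
                then show False using False u(1) by (auto simp del: comp_apply)
              qed
            qed
            with False show ?thesis
              by (simp add: Neighbor_Query ans_Neighbor_Query_None del: comp_apply)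
          qed
        qed
        moreover have "st even_pos (t + 1) j = Ask x k" using IH Ask by simp
        ultimately show ?thesis using Ask by (simp only: Suc st_Suc step_simps)
      qed
    qed
  qed
  with adm show ?thesis using that by blast
qed

text \<open>Homogeneity moves the run at \<open>t\<close> to \<psi>, where it coincides with the run
  at \<open>t + 1\<close>. Only outputs and label queries carry over, as they do not refer to the
  labelling; neighbour queries travel with the start.\<close>

lemma
  assumes t: "q \<le> t" "t + q + 1 < n" and p: "p \<le> q"
    and far: "cyc_ball q (queried p t) \<inter> {t - q..t + q + 1} = {}"
  shows act_shift_Label_At: "act even_pos (t + 1) p = Label_At u \<longleftrightarrow> act even_pos t p = Label_At u"
    and act_shift_Returns: "act even_pos (t + 1) p = Returns b \<longleftrightarrow> act even_pos t p = Returns b"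
proof -
  obtain \<psi> where adm: "admissible n \<psi>" and st: "st \<psi> t p = st even_pos (t + 1) p"
    using st_shift[OF assms] .
  have "act even_pos t p = act \<psi> t p"
    using act_even_pos[OF adm, of t p] t p by simp
  then show "act even_pos (t + 1) p = Label_At u \<longleftrightarrow> act even_pos t p = Label_At u"
    and "act even_pos (t + 1) p = Returns b \<longleftrightarrow> act even_pos t p = Returns b"
    using st by (simp_all add: act_def action_Label_At action_Returns)
qed

end

section \<open>Bounding the vertices reached by label queries\<close>

text \<open>Going upwards from \<open>0\<close>, a new value can appear only immediately after an
  element of \<open>B\<close>.\<close>

lemma card_image_le_changes:
  fixes g :: "nat \<Rightarrow> 'a"
  assumes "finite B" "\<And>t. t + 1 < n \<Longrightarrow> t \<notin> B \<Longrightarrow> g (t + 1) = g t"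
  shows "card (g ` {..<n}) \<le> card B + 1"
proof -
  have "g t \<in> insert (g 0) ((\<lambda>t. g (t + 1)) ` B)" if "t < n" for t
    using that
  proof (induction t)
    case (Suc t)
    then show ?case using assms(2)[of t] by (cases "t \<in> B") auto
  qed simp
  then have "g ` {..<n} \<subseteq> insert (g 0) ((\<lambda>t. g (t + 1)) ` B)" by blast
  then have "card (g ` {..<n}) \<le> card (insert (g 0) ((\<lambda>t. g (t + 1)) ` B))"
    using assms(1) by (intro card_mono) simp_all
  also have "\<dots> \<le> card ((\<lambda>t. g (t + 1)) ` B) + 1"
    using card_insert_le_m1 by (simp add: card_insert_if assms(1))
  also have "\<dots> \<le> card B + 1"
    using card_image_le[OF assms(1)] by simp
  finally show ?thesis .
qed

text \<open>The two ends of the cycle account for \<open>q + (q + 1)\<close> positions, and each of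
  at most \<open>3 ^ q * m\<close> points in the ball excludes a window of
  \<open>2 * q + 2\<close>.\<close>

definition near_bound :: "nat \<Rightarrow> nat \<Rightarrow> nat" where
  "near_bound q m = 2 * q + 1 + (2 * q + 2) * (3 ^ q * m)"

text \<open>The increment bounds the number of distinct label queries at step \<open>p\<close>: one
  for position \<open>0\<close> and one for each possible change.\<close>

primrec query_bound :: "nat \<Rightarrow> nat \<Rightarrow> nat" where
  "query_bound q 0 = 0"
| "query_bound q (Suc p) = query_bound q p + (near_bound q (query_bound q p) + 1)"

context homogeneous_labels
begin

definition all_queried :: "nat \<Rightarrow> nat set" where
  "all_queried p = (\<Union>t<n. queried p t)"

text \<open>A single exceptional set for all runs: outside it, the comparison of \<open>t\<close>
  with \<open>t + 1\<close> applies. The window covers the radius \<open>q\<close> intervals around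
  both.\<close>

definition near :: "nat \<Rightarrow> nat set" where
  "near p = {t. t < n \<and> \<not> (q \<le> t \<and> t + q + 1 < n \<and>
      cyc_ball q (all_queried p) \<inter> {t - q..t + q + 1} = {})}"

lemma finite_near: "finite (near p)"
  by (simp add: near_def)

lemma
  assumes "t + 1 < n" "t \<notin> near p" "p \<le> q"
  shows act_not_near_Label_At: "act even_pos (t + 1) p = Label_At u \<longleftrightarrow> act even_pos t p = Label_At u"
    and act_not_near_Returns: "act even_pos (t + 1) p = Returns b \<longleftrightarrow> act even_pos t p = Returns b"
proof -
  have t: "q \<le> t" "t + q + 1 < n" "cyc_ball q (all_queried p) \<inter> {t - q..t + q + 1} = {}"
    using assms by (auto simp: near_def)
  have "cyc_ball q (queried p t) \<subseteq> cyc_ball q (all_queried p)"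
    using assms(1) by (intro cyc_ball_mono) (auto simp: all_queried_def intro!: bexI[of _ t])
  with t(3) have far: "cyc_ball q (queried p t) \<inter> {t - q..t + q + 1} = {}" by blast
  show "act even_pos (t + 1) p = Label_At u \<longleftrightarrow> act even_pos t p = Label_At u"
    by (rule act_shift_Label_At[OF t(1,2) assms(3) far])
  show "act even_pos (t + 1) p = Returns b \<longleftrightarrow> act even_pos t p = Returns b"
    by (rule act_shift_Returns[OF t(1,2) assms(3) far])
qed

lemma card_near_le:
  assumes "finite (all_queried p)"
  shows "card (near p) \<le> near_bound q (card (all_queried p))"
proof -
  let ?K = "cyc_ball q (all_queried p)"
  \<comment> \<open>The window condition on \<open>t\<close> solved for \<open>t\<close>, given a
    point \<open>k\<close> of the ball.\<close>
  let ?U = "\<Union>k\<in>?K. {k - (q + 1)..k + q}"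
  have fin: "finite ?K" using assms by (rule finite_cyc_ball)
  have "near p \<subseteq> {..<q} \<union> {n - (q + 1)..<n} \<union> ?U"
  proof
    fix t assume t: "t \<in> near p"
    show "t \<in> {..<q} \<union> {n - (q + 1)..<n} \<union> ?U"
    proof (cases "q \<le> t \<and> t + q + 1 < n")
      case True
      with t have "?K \<inter> {t - q..t + q + 1} \<noteq> {}" by (simp add: near_def)
      then obtain k where "k \<in> ?K" "k \<in> {t - q..t + q + 1}" by blast
      then show ?thesis by (auto intro!: bexI[of _ k])
    next
      case False
      with t show ?thesis by (auto simp: near_def)
    qed
  qed
  then have "card (near p) \<le> card ({..<q} \<union> {n - (q + 1)..<n} \<union> ?U)"
    using fin by (intro card_mono) auto
  also have "\<dots> \<le> card {..<q} + card {n - (q + 1)..<n} + card ?U"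
    by (meson card_Un_le add_le_mono le_trans order.refl)
  also have "card ?U \<le> (\<Sum>k\<in>?K. card {k - (q + 1)..k + q})"
    by (rule card_UN_le[OF fin])
  also have "\<dots> \<le> (\<Sum>k\<in>?K. 2 * q + 2)"
    by (intro sum_mono) simp
  also have "\<dots> = (2 * q + 2) * card ?K" by simp
  also have "\<dots> \<le> (2 * q + 2) * (3 ^ q * card (all_queried p))"
    using card_cyc_ball_le[OF assms] by (rule mult_le_mono2)
  also have "card {n - (q + 1)..<n} \<le> q + 1" by simp
  finally show ?thesis by (simp add: near_bound_def)
qed

lemma near_bound_mono: "m \<le> m' \<Longrightarrow> near_bound q m \<le> near_bound q m'"
  unfolding near_bound_def by (intro add_left_mono mult_le_mono2)

lemma all_queried_Suc:
  "all_queried (Suc p) = all_queried p \<union> \<Union> ((\<lambda>t. {u. act even_pos t p = Label_At u}) ` {..<n})"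
  by (auto simp: all_queried_def queried_def less_Suc_eq)

text \<open>The queries of the first \<open>p\<close> steps determine \<open>near p\<close>, and
  outside it consecutive runs make the same label query at step \<open>p\<close>. So step
  \<open>p\<close> adds at most \<open>card (near p) + 1\<close> vertices, each run contributing at
  most one.\<close>

lemma all_queried_bound:
  "p \<le> q \<Longrightarrow> finite (all_queried p) \<and> card (all_queried p) \<le> query_bound q p"
proof (induction p)
  case 0
  then show ?case by (simp add: all_queried_def queried_def)
next
  case (Suc p)
  define g where "g t = {u. act even_pos t p = Label_At u}" for t
  from Suc have fin: "finite (all_queried p)"
    and le: "card (all_queried p) \<le> query_bound q p" by simp_all
  have single: "finite (g t) \<and> card (g t) \<le> 1" for t
    unfolding g_def by (cases "act even_pos t p") auto
  have "card (\<Union> (g ` {..<n})) \<le> (\<Sum>X\<in>g ` {..<n}. card X)"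
    using card_UN_le[of "g ` {..<n}" id] by simp
  also have "\<dots> \<le> (\<Sum>X\<in>g ` {..<n}. 1)"
    using single by (intro sum_mono) auto
  also have "\<dots> = card (g ` {..<n})" by simp
  also have "\<dots> \<le> card (near p) + 1"
    using act_not_near_Label_At Suc.prems
    by (intro card_image_le_changes[OF finite_near]) (auto simp: g_def)
  also have "\<dots> \<le> near_bound q (query_bound q p) + 1"
    using card_near_le[OF fin] near_bound_mono[OF le] by simp
  finally have "card (all_queried (Suc p)) \<le> query_bound q (Suc p)"
    using card_Un_le[of "all_queried p" "\<Union> (g ` {..<n})"] le
    by (simp add: all_queried_Suc g_def[symmetric])
  moreover have "finite (all_queried (Suc p))"
    using fin single by (simp add: all_queried_Suc g_def[symmetric])
  ultimately show ?case by blast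
qed

section \<open>Counting uncut vertices\<close>

text \<open>Depends on \<open>e\<close> and the order of the cycle but not on the oracle, so one
  labelling serves all seeds.\<close>

definition lab :: "nat \<Rightarrow> nat" where
  "lab v = e (2 * pos v)"

lemma answer_lab: "answer n adj lab = ans (e \<circ> even_pos)"
  by (simp add: ans_def lab_def[abs_def] even_pos_def)

definition cut :: "nat set" where
  "cut = cut_vertices n adj lab A"

lemma uncut_iff_act:
  assumes "t < n" "num_queries (answer n adj lab) (A (lab (c t))) \<le> q"
  shows "c t \<notin> cut \<longleftrightarrow> act even_pos t q = Returns False"
proof -
  have "st even_pos t q = Output (result (answer n adj lab) (A (lab (c t))))"
    using state_eq_Output[OF assms(2)] assms(1)
    by (simp add: st_def answer_lab lab_def even_pos_def)
  then show "c t \<notin> cut \<longleftrightarrow> act even_pos t q = Returns False"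
    using assms(1) c_less by (auto simp: cut_def cut_vertices_def act_def)
qed

lemma component_subset:
  assumes "v < n"
  shows "component n adj C v \<subseteq> {..<n}"
proof
  fix w assume "w \<in> component n adj C v"
  then have "(v, w) \<in> {(x, y). x < n \<and> y \<in> set (adj x) \<and> x \<notin> C \<and> y \<notin> C}\<^sup>*"
    by (simp add: component_def)
  then have "w < n"
  proof (induction rule: rtrancl_induct)
    case (step x y)
    then have "x < n" "y \<in> set (adj x)" by auto
    then show ?case
      using adj_c[OF pos_less[of x]] n_ge_3 by (auto simp: c_less)
  qed (fact assms)
  then show "w \<in> {..<n}" by simp
qed

lemma run_in_component:
  assumes "t + m < n" "\<And>i. i \<le> m \<Longrightarrow> c (t + i) \<notin> C"
  shows "c (t + m) \<in> component n adj C (c t)"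
  using assms
proof (induction m)
  case 0
  then show ?case by (simp add: component_def)
next
  case (Suc m)
  then have "c (t + m) \<in> component n adj C (c t)" by simp
  moreover have "c (t + Suc m) \<in> set (adj (c (t + m)))" "c (t + m) < n"
    using Suc.prems adj_c[of "t + m"] by (simp_all add: c_less)
  moreover have "c (t + m) \<notin> C" "c (t + Suc m) \<notin> C"
    using Suc.prems(2)[of m] Suc.prems(2)[of "Suc m"] by simp_all
  ultimately show ?case
    unfolding component_def by (auto intro: rtrancl_into_rtrancl)
qed

text \<open>Outside \<open>near q\<close> the output does not change from one position to the next, so \<open>q + 1\<close>
  consecutive uncut positions away from \<open>near q\<close> would form too large a component.\<close>

lemma uncut_near:
  assumes queries: "\<And>v. v < n \<Longrightarrow> num_queries (answer n adj lab) (A (lab v)) \<le> q"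
    and components: "\<And>v. v < n \<Longrightarrow> card (component n adj cut v) \<le> q"
    and t: "t < n" "c t \<notin> cut"
  shows "\<exists>b\<in>near q. t \<in> {b - q..b}"
proof (rule ccontr)
  assume "\<not> ?thesis"
  then have not_near: "b \<notin> near q" if "t \<le> b" "b \<le> t + q" for b
    using that by force
  \<comment> \<open>The last position \<open>n - 1\<close> always belongs to \<open>near q\<close>,
    so a stretch avoiding that set cannot reach the end.\<close>
  have "t + q < n"
  proof (rule ccontr)
    assume "\<not> t + q < n"
    then have "n - 1 \<notin> near q" using t(1) by (intro not_near) auto
    then show False using t(1) by (auto simp: near_def)
  qed
  have uncut: "c (t + i) \<notin> cut" if "i \<le> q" for i
    using that
  proof (induction i)
    case (Suc i)
    then show ?case
      using act_not_near_Returns[of "t + i" q False] not_near[of "t + i"] \<open>t + q < n\<close>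
        uncut_iff_act[OF _ queries[OF c_less], of "t + i"]
        uncut_iff_act[OF _ queries[OF c_less], of "t + Suc i"]
      by simp
  qed (simp add: t)
  have "(\<lambda>i. c (t + i)) ` {..q} \<subseteq> component n adj cut (c t)"
    using run_in_component[of t _ cut] uncut \<open>t + q < n\<close> by auto
  moreover have "finite (component n adj cut (c t))"
    using component_subset[OF c_less[OF t(1)]] finite_subset by blast
  ultimately have "card ((\<lambda>i. c (t + i)) ` {..q}) \<le> q"
    using components[OF c_less[OF t(1)]] card_mono le_trans by blast
  moreover have "inj_on (\<lambda>i. c (t + i)) {..q}"
  proof (rule inj_onI)
    fix i j assume "i \<in> {..q}" "j \<in> {..q}" "c (t + i) = c (t + j)"
    then show "i = j"
      using inj_onD[OF bij_betw_imp_inj_on[OF bij_c], of "t + i" "t + j"] \<open>t + q < n\<close> by simp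
  qed
  ultimately show False by (simp add: card_image)
qed

text \<open>Each position in \<open>near q\<close> accounts for at most \<open>q + 1\<close> uncut
  positions.\<close>

lemma card_cut_ge:
  assumes queries: "\<And>v. v < n \<Longrightarrow> num_queries (answer n adj lab) (A (lab v)) \<le> q"
    and components: "\<And>v. v < n \<Longrightarrow> card (component n adj cut v) \<le> q"
  shows "n \<le> card cut + (q + 1) * near_bound q (query_bound q q)"
proof -
  let ?U = "\<Union>b\<in>near q. {b - q..b}"
  have "{..<n} \<subseteq> cut \<union> c ` ?U"
  proof
    fix v assume v: "v \<in> {..<n}"
    then have pos: "pos v < n" "c (pos v) = v" by (simp_all add: pos_less)
    show "v \<in> cut \<union> c ` ?U"
    proof (cases "v \<in> cut")
      case False
      then obtain b where "b \<in> near q" "pos v \<in> {b - q..b}"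
        using uncut_near[OF queries components pos(1)] pos(2) by auto
      then have "c (pos v) \<in> c ` ?U" by blast
      then show ?thesis using pos(2) by simp
    qed simp
  qed
  then have "n \<le> card (cut \<union> c ` ?U)"
    using finite_near card_mono[of "cut \<union> c ` ?U" "{..<n}"]
    by (simp add: cut_def cut_vertices_def)
  also have "\<dots> \<le> card cut + card (c ` ?U)" by (rule card_Un_le)
  also have "card (c ` ?U) \<le> card ?U"
    using finite_near by (intro card_image_le) simp
  also have "\<dots> \<le> (\<Sum>b\<in>near q. card {b - q..b})"
    by (rule card_UN_le[OF finite_near])
  also have "\<dots> \<le> (\<Sum>b\<in>near q. q + 1)"
    by (intro sum_mono) simp
  also have "\<dots> = (q + 1) * card (near q)" by simp
  also have "\<dots> \<le> (q + 1) * near_bound q (query_bound q q)"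
    using card_near_le[of q] all_queried_bound[of q] near_bound_mono le_trans
    by (intro mult_le_mono2) blast
  finally show ?thesis by simp
qed

end

section \<open>Homogeneous labels from Ramsey's theorem\<close>

text \<open>Colours are attached to sets, homogeneity speaks of selections; this recovers the
  selection from its set of labels.\<close>

lemma sorted_list_of_set_image_strict_mono:
  fixes f :: "nat \<Rightarrow> nat"
  assumes "strict_mono_on {..<n} f"
  shows "sorted_list_of_set (f ` {..<n}) = map f [0..<n]"
proof -
  have "sorted_wrt (<) (map f [0..<n])"
    using assms by (auto simp: sorted_wrt_map sorted_wrt_iff_nth_less strict_mono_on_def)
  then show ?thesis
    using sorted_list_of_set.idem_if_sorted_distinct[of "map f [0..<n]"]
    by (simp add: strict_sorted_iff atLeast0LessThan)
qed

lemma finite_seeds: "finite (seeds r)"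
  using finite_lists_length_eq[of "UNIV :: bool set" r] by (simp add: seeds_def)

lemma seeds_nonempty: "seeds r \<noteq> {}"
  unfolding seeds_def using Ex_list_of_length[of r] by blast

text \<open>One \<open>M\<close> must serve all oracles and cycles, since \<open>N\<close> is fixed
  before they are.\<close>

definition label_bound :: "nat \<Rightarrow> nat \<Rightarrow> nat \<Rightarrow> nat \<Rightarrow> bool" where
  "label_bound n q r M \<longleftrightarrow> (\<forall>(T :: bool list \<Rightarrow> cut_oracle) adj c. directed_cycle n adj c \<longrightarrow>
     (\<exists>e. e ` {..<2 * n} \<subseteq> {..<M} \<and> (\<forall>s\<in>seeds r. homogeneous_labels n adj c q (T s) e)))"

text \<open>An \<open>n\<close>-subset of labels is coloured by the table of all actions, over
  positions, times up to \<open>q\<close> and seeds. The number of possible tables depends only on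
  \<open>n\<close>, \<open>q\<close> and \<open>r\<close>, and including the seeds yields one
  \<open>e\<close> for all of them.\<close>

lemma ex_label_bound: "\<exists>M. label_bound n q r M"
proof -
  define Acts where
    "Acts = range Returns \<union> Label_At ` {..<n} \<union> Neighbor_At ` {..<n} \<union> {Void}"
  define I where "I = {..<n} \<times> {..q} \<times> seeds r"
  define E where "E = I \<rightarrow>\<^sub>E Acts"
  have "finite E"
    unfolding E_def I_def Acts_def using finite_seeds by (intro finite_PiE) auto
  then obtain h where h: "bij_betw h E {0..<card E}"
    using ex_bij_betw_finite_nat by blast
  \<comment> \<open>Every colour gets the target size \<open>2 * n\<close>: twice the number of
    vertices, to provide the spare labels.\<close>
  obtain M :: nat where M: "partn_lst {..<M} (replicate (card E) (2 * n)) n"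
    using ramsey_full by blast
  have "label_bound n q r M"
    unfolding label_bound_def
  proof (intro allI impI)
    fix T :: "bool list \<Rightarrow> cut_oracle" and adj c
    assume "directed_cycle n adj c"
    then interpret directed_cycle n adj c .
    define enum where "enum X i = sorted_list_of_set X ! i" for X :: "nat set" and i
    define beh where "beh \<rho> = (\<lambda>(t, p, s)\<in>I. action \<rho> (state (ans \<rho>) (T s (\<rho> t)) p))" for \<rho>
    have "h (beh (enum X)) < card E" if "X \<in> nsets {..<M} n" for X
    proof -
      have "finite X" "card X = n" using that by (auto simp: nsets_def)
      then have "inj_on (enum X) {..<n}"
        by (auto simp: inj_on_def enum_def nth_eq_iff_index_eq)
      then have "beh (enum X) \<in> E"
        using action_in by (auto simp: beh_def E_def Acts_def)
      then show ?thesis using bij_betwE[OF h] by auto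
    qed
    then have "(\<lambda>X. h (beh (enum X))) \<in> nsets {..<M} n \<rightarrow> {..<length (replicate (card E) (2 * n))}"
      by auto
    then obtain i where "i < card E"
      "monochromatic {..<M} (replicate (card E) (2 * n) ! i) n (\<lambda>X. h (beh (enum X))) i"
      using M unfolding partn_lst_def by (metis length_replicate)
    then obtain H where H: "H \<in> nsets {..<M} (2 * n)"
      and mono: "(\<lambda>X. h (beh (enum X))) ` nsets H n \<subseteq> {i}"
      unfolding monochromatic_def by (metis nth_replicate)
    define e where "e = enum H"
    have H': "finite H" "card H = 2 * n" "H \<subseteq> {..<M}"
      using H by (auto simp: nsets_def)
    have e_H: "e ` {..<2 * n} \<subseteq> H"
      using H' by (auto simp: e_def enum_def) (metis length_sorted_list_of_set nth_mem set_sorted_list_of_set)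
    have e_mono: "strict_mono_on {..<2 * n} e"
      using H' by (auto simp: e_def enum_def strict_mono_on_def intro!: sorted_wrt_nth_less[of "(<)"])
    have beh_eq: "h (beh (e \<circ> \<psi>)) = i \<and> beh (e \<circ> \<psi>) \<in> E" if adm: "admissible n \<psi>" for \<psi>
    proof -
      define X where "X = (e \<circ> \<psi>) ` {..<n}"
      have range: "\<psi> k < 2 * n" if "k < n" for k
        using adm that by (auto simp: admissible_def)
      have mono_comp: "strict_mono_on {..<n} (e \<circ> \<psi>)"
        using adm e_mono range by (auto simp: admissible_def strict_mono_on_def)
      then have inj: "inj_on (e \<circ> \<psi>) {..<n}" by (rule strict_mono_on_imp_inj_on)
      then have "X \<in> nsets H n"
        using e_H range card_image[OF inj] by (auto simp: X_def nsets_def)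
      then have col: "h (beh (enum X)) = i" using mono by auto
      have eq: "(e \<circ> \<psi>) k = enum X k" if "k < n" for k
        using that unfolding enum_def X_def sorted_list_of_set_image_strict_mono[OF mono_comp]
        by simp
      have "ans (e \<circ> \<psi>) = ans (enum X)"
        by (rule ans_cong[OF inj eq])
      moreover have "action (e \<circ> \<psi>) = action (enum X)"
        by (rule ext, rule action_cong[OF eq])
      ultimately have "beh (e \<circ> \<psi>) = beh (enum X)"
        unfolding beh_def using eq by (intro restrict_ext) (auto simp: I_def)
      moreover have "beh (e \<circ> \<psi>) \<in> E"
        using action_in[OF inj] by (auto simp: beh_def E_def Acts_def)
      ultimately show ?thesis using col by simp
    qed
    have "homogeneous_labels n adj c q (T s) e" if s: "s \<in> seeds r" for s
    proof unfold_locales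
      show "inj_on e {..<2 * n}" using e_mono by (rule strict_mono_on_imp_inj_on)
      fix \<psi> \<psi>' :: "nat \<Rightarrow> nat" and t p
      assume adm: "admissible n \<psi>" "admissible n \<psi>'" and tp: "t < n" "p \<le> q"
      \<comment> \<open>\<open>h\<close> is injective on \<open>E\<close>, so equal colours mean
        equal tables.\<close>
      have "beh (e \<circ> \<psi>) = beh (e \<circ> \<psi>')"
        using beh_eq[OF adm(1)] beh_eq[OF adm(2)] h by (metis bij_betw_inv_into_left)
      then have "beh (e \<circ> \<psi>) (t, p, s) = beh (e \<circ> \<psi>') (t, p, s)" by simp
      then show "action (e \<circ> \<psi>) (state (ans (e \<circ> \<psi>)) (T s (e (\<psi> t))) p) =
          action (e \<circ> \<psi>') (state (ans (e \<circ> \<psi>')) (T s (e (\<psi>' t))) p)"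
        using s tp by (simp add: beh_def I_def)
    qed
    then show "\<exists>e. e ` {..<2 * n} \<subseteq> {..<M} \<and> (\<forall>s\<in>seeds r. homogeneous_labels n adj c q (T s) e)"
      using e_H H'(3) by blast
  qed
  then show ?thesis ..
qed

section \<open>Choice of the bounds and conclusion\<close>

text \<open>The bound on \<open>N\<close> may depend on \<open>n\<close> only; summing over all
  \<open>q\<close> and \<open>r\<close> up to \<open>n\<close> dominates every case once
  \<open>n\<close> exceeds both.\<close>

definition enough_labels :: "nat \<Rightarrow> nat" where
  "enough_labels n = (\<Sum>q\<le>n. \<Sum>r\<le>n. SOME M. label_bound n q r M)"

lemma label_bound_mono: "label_bound n q r M \<Longrightarrow> M \<le> N \<Longrightarrow> label_bound n q r N"
  unfolding label_bound_def by (meson lessThan_subset_iff subset_trans)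

lemma label_bound_enough_labels:
  assumes "q \<le> n" "r \<le> n"
  shows "label_bound n q r (enough_labels n)"
proof (rule label_bound_mono)
  show "label_bound n q r (SOME M. label_bound n q r M)"
    using ex_label_bound by (rule someI_ex)
  have "(SOME M. label_bound n q r M) \<le> (\<Sum>r\<le>n. SOME M. label_bound n q r M)"
    using assms by (intro member_le_sum) auto
  also have "\<dots> \<le> enough_labels n"
    unfolding enough_labels_def using assms
    by (intro member_le_sum[of q "{..n}" "\<lambda>q. \<Sum>r\<le>n. SOME M. label_bound n q r M"]) auto
  finally show "(SOME M. label_bound n q r M) \<le> enough_labels n" .
qed

lemma partition_oracleD:
  assumes "partition_oracle q n N A" "n_cycle n adj" "labeling n N lab" "v < n"
  shows "num_queries (answer n adj lab) (A (lab v)) \<le> q"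
    and "card (component n adj (cut_vertices n adj lab A) v) \<le> q"
  using assms by (auto simp: partition_oracle_def)

lemma ex_labeling_mostly_cut:
  assumes n: "q \<le> n" "r \<le> n" "100 * ((q + 1) * near_bound q (query_bound q q)) \<le> n"
    and N: "enough_labels n \<le> N"
    and T: "randomized_partition_oracle q r n N T"
    and cyc: "oriented_n_cycle n adj"
  shows "\<exists>lab. labeling n N lab \<and>
    (\<forall>s\<in>seeds r. 0.99 * real n \<le> real (card (cut_vertices n adj lab (T s))))"
proof -
  obtain c where n_cycle: "n_cycle n adj" and "bij_betw c {..<n} {..<n}"
    and "\<forall>i<n. adj (c i) = [c ((i + 1) mod n), c ((i + n - 1) mod n)]"
    using cyc unfolding oriented_n_cycle_def by blast
  moreover have "3 \<le> n" using n_cycle by (simp add: n_cycle_def)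
  ultimately have "directed_cycle n adj c" by (simp add: directed_cycle_def)
  then interpret directed_cycle n adj c .
  have "label_bound n q r N"
    using label_bound_mono[OF label_bound_enough_labels[OF n(1,2)] N] .
  then have "\<exists>e. e ` {..<2 * n} \<subseteq> {..<N} \<and> (\<forall>s\<in>seeds r. homogeneous_labels n adj c q (T s) e)"
    unfolding label_bound_def using directed_cycle_axioms by (elim allE impE)
  then obtain e where e: "e ` {..<2 * n} \<subseteq> {..<N}"
    and hom: "\<And>s. s \<in> seeds r \<Longrightarrow> homogeneous_labels n adj c q (T s) e"
    by blast
  \<comment> \<open>Any seed will do: it only gives access to \<open>lab\<close>, which is the same
    for all seeds.\<close>
  obtain s0 where "s0 \<in> seeds r" using seeds_nonempty by blast
  then interpret s0: homogeneous_labels n adj c q "T s0" e by (rule hom)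
  have lab: "labeling n N s0.lab"
    unfolding labeling_def
  proof
    show "inj_on s0.lab {..<n}"
      using inj_on_label_pos[OF s0.inj_on_e_comp[OF s0.admissible_even_pos]]
      by (simp add: s0.lab_def[abs_def] s0.even_pos_def)
    show "s0.lab ` {..<n} \<subseteq> {..<N}"
    proof (rule image_subsetI)
      fix v assume "v \<in> {..<n}"
      then have "2 * pos v \<in> {..<2 * n}" by (simp add: pos_less)
      then show "s0.lab v \<in> {..<N}" unfolding s0.lab_def using e by blast
    qed
  qed
  have "0.99 * real n \<le> real (card (cut_vertices n adj s0.lab (T s)))" if s: "s \<in> seeds r" for s
  proof -
    interpret s: homogeneous_labels n adj c q "T s" e by (rule hom[OF s])
    have "partition_oracle q n N (T s)"
      using T s by (simp add: randomized_partition_oracle_def)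
    note bounds = partition_oracleD[OF this n_cycle lab]
    have "n \<le> card s.cut + (q + 1) * near_bound q (query_bound q q)"
      using s.card_cut_ge[unfolded s.cut_def, OF bounds] unfolding s.cut_def .
    then have "99 * n \<le> 100 * card s.cut" using n(3) by linarith
    then have "99 * real n \<le> 100 * real (card s.cut)" by linarith
    then show ?thesis by (simp add: s.cut_def power2_eq_square)
  qed
  with lab show ?thesis by blast
qed

theorem theorem2p4:
  "\<exists>F :: nat \<Rightarrow> nat. \<forall>q R :: nat. \<exists>n0 :: nat. \<forall>n \<ge> n0. \<forall>N \<ge> F n. \<forall>r \<le> R.
     \<forall>(T :: bool list \<Rightarrow> cut_oracle) (adj :: nat \<Rightarrow> nat list).
       randomized_partition_oracle q r n N T \<longrightarrow> oriented_n_cycle n adj \<longrightarrow>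
       (\<exists>lab. labeling n N lab \<and>
          measure_pmf.prob (pmf_of_set (seeds r))
            {s. real (card (cut_vertices n adj lab (T s))) \<ge> 0.99 * real n} = 1)"
proof (rule exI[of _ enough_labels], intro allI,
    rule exI[where x = "max q (max R (100 * ((q + 1) * near_bound q (query_bound q q))))" for q R],
    intro allI impI)
  fix q R n N r and T :: "bool list \<Rightarrow> cut_oracle" and adj
  assume n: "max q (max R (100 * ((q + 1) * near_bound q (query_bound q q)))) \<le> n"
    and N: "enough_labels n \<le> N" and r: "r \<le> R"
    and T: "randomized_partition_oracle q r n N T" and adj: "oriented_n_cycle n adj"
  \<comment> \<open>The threshold lets \<open>enough_labels n\<close> cover \<open>q\<close> and
    \<open>r\<close>, and its factor \<open>100\<close> keeps the uncut vertices within one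
    percent.\<close>
  have "q \<le> n" "r \<le> n" "100 * ((q + 1) * near_bound q (query_bound q q)) \<le> n"
    using n r by simp_all
  from ex_labeling_mostly_cut[OF this N T adj]
  obtain lab where lab: "labeling n N lab"
    and cut: "\<forall>s\<in>seeds r. 0.99 * real n \<le> real (card (cut_vertices n adj lab (T s)))"
    by blast
  have "measure_pmf.prob (pmf_of_set (seeds r))
      {s. real (card (cut_vertices n adj lab (T s))) \<ge> 0.99 * real n} = 1"
    using cut set_pmf_of_set[OF seeds_nonempty finite_seeds, of r]
    by (subst measure_pmf.prob_eq_1) (simp_all add: AE_measure_pmf_iff)
  with lab show "\<exists>lab. labeling n N lab \<and>
      measure_pmf.prob (pmf_of_set (seeds r))
        {s. real (card (cut_vertices n adj lab (T s))) \<ge> 0.99 * real n} = 1"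
    by (intro exI conjI)
qed

end
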